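(* Let assumptions (A1)--(A5) listed in the context hold, and consider the minimization of $$H(u)=\int_{1/\lambda_{\min}}^{T}\mathbb E\left[\left(u\left(s-\frac1\lambda\right)-D(s)\right)^2\right]\,\mathrm ds$$ over the space $U_n$ of controls that are piecewise constant on the partition $\Pi_n$ of $I_{\mathrm{ctrl}}$. For every cell $[t_i,t_{i+1})$ with $Q_i^{(n)}>0$, the unique optimal coefficient is $$u_i^{(n),*}=\frac{M_i^{(n)}}{Q_i^{(n)}}=\frac{\displaystyle\int_{t_i}^{t_{i+1}}q(t)u^*(t)\,\mathrm dt}{\displaystyle\int_{t_i}^{t_{i+1}}q(t)\,\mathrm dt}.$$
   Context: Let $(\Omega,\mathcal F,\mathbb P)$ be a probability space, $0<\lambda_{\min}<\lambda_{\max}$, and $T>1/\lambda_{\min}$. Assumptions: (A1) $\lambda:\Omega\to\mathbb R$ is a random variable with $\lambda_{\min}\le\lambda\le\lambda_{\max}$ almost surely. (A2) The cumulative distribution function $F_\lambda$ of $\lambda$ belongs to $C^1([\lambda_{\min},\lambda_{\max}])$, and $\lambda$ has density $\phi_\lambda$. (A3) $D:[0,T]\times\Omega\to[0,\infty)$ is jointly measurable and $D\in L^2(\Omega\times(0,T))$. (A4) $m(t):=\mathbb E[D(t)]$. (A5) $\lambda$ is independent of the process $D$, i.e. $\sigma(\lambda)$ and $\sigma(D(t):t\in[0,T])$ are independent. Notation: $I_{\mathrm{ctrl}}:=[0,T-1/\lambda_{\max}]$. For $t\in I_{\mathrm{ctrl}}$, $\Lambda(t):=\{\ell\in[\lambda_{\min},\lambda_{\max}]:1/\lambda_{\min}\le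 t+1/\ell\le T\}$ and $q(t):=\int_{\Lambda(t)}\phi_\lambda(\ell)\,\mathrm d\ell$. For $t$ with $q(t)>0$, $$u^*(t):=\frac1{q(t)}\int_{\Lambda(t)}m\left(t+\frac1\ell\right)\phi_\lambda(\ell)\,\mathrm d\ell$$ (the continuous-time optimal control); where $q(t)=0$ the product $q(t)u^*(t)$ is read as $0$. Let $\Pi_n=\{0=t_0<t_1<\dots<t_{n+1}=T-1/\lambda_{\max}\}$ be a partition of $I_{\mathrm{ctrl}}$ and $U_n$ the space of functions $u^{(n)}$ with $u^{(n)}(t)=u_i^{(n)}\in\mathbb R$ for $t\in[t_i,t_{i+1})$, $i=0,\dots,n$. Define $$Q_i^{(n)}:=\int_{t_i}^{t_{i+1}}q(t)\,\mathrm dt,\qquad M_i^{(n)}:=\int_{t_i}^{t_{i+1}}\int_{\Lambda(t)}m\left(t+\frac1\ell\right)\phi_\lambda(\ell)\,\mathrm d\ell\,\mathrm dt.$$ Coefficients on cells with $Q_i^{(n)}=0$ do not affect $H$. *)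

theory Defs
  imports "HOL-Probability.Probability"
begin

text \<open>
  The library's \<open>C1_differentiable_on\<close> asks for two-sided derivatives at the end points of the
  interval, which would exclude, for instance, the uniform distribution; here the derivative at
  an end point is one-sided.
\<close>

definition C1_on_Icc :: "(real \<Rightarrow> real) \<Rightarrow> real \<Rightarrow> real \<Rightarrow> bool" where
  "C1_on_Icc f a b \<longleftrightarrow>
     (\<exists>f'. continuous_on {a..b} f' \<and>
           (\<forall>x\<in>{a..b}. (f has_real_derivative f' x) (at x within {a..b})))"

definition indep_rv_process ::
    "'a measure \<Rightarrow> real \<Rightarrow> ('a \<Rightarrow> real) \<Rightarrow> (real \<Rightarrow> 'a \<Rightarrow> real) \<Rightarrow> bool" where
  "indep_rv_process M T lam D \<longleftrightarrow>
     prob_space.indep_set M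
       (sigma_sets (space M) {lam -` B \<inter> space M | B. B \<in> sets borel})
       (sigma_sets (space M) {D t -` B \<inter> space M | t B. t \<in> {0..T} \<and> B \<in> sets borel})"

definition I_ctrl :: "real \<Rightarrow> real \<Rightarrow> real set" where
  "I_ctrl lmax T = {0..T - 1 / lmax}"

definition Lam :: "real \<Rightarrow> real \<Rightarrow> real \<Rightarrow> real \<Rightarrow> real set" where
  "Lam lmin lmax T t = {l \<in> {lmin..lmax}. 1 / lmin \<le> t + 1 / l \<and> t + 1 / l \<le> T}"

definition mean :: "'a measure \<Rightarrow> (real \<Rightarrow> 'a \<Rightarrow> real) \<Rightarrow> real \<Rightarrow> real" where
  "mean M D t = (\<integral>\<omega>. D t \<omega> \<partial>M)"

definition q :: "real \<Rightarrow> real \<Rightarrow> real \<Rightarrow> (real \<Rightarrow> real) \<Rightarrow> real \<Rightarrow> real" where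
  "q lmin lmax T \<phi> t = (LINT l:Lam lmin lmax T t|lborel. \<phi> l)"

text \<open>Where \<open>q\<close> vanishes, \<open>u_star\<close> is \<open>0\<close> because of division by zero, so \<open>q * u_star\<close> is \<open>0\<close> there.\<close>

definition u_star ::
    "real \<Rightarrow> real \<Rightarrow> real \<Rightarrow> (real \<Rightarrow> real) \<Rightarrow> (real \<Rightarrow> real) \<Rightarrow> real \<Rightarrow> real" where
  "u_star lmin lmax T \<phi> m t =
     1 / q lmin lmax T \<phi> t * (LINT l:Lam lmin lmax T t|lborel. m (t + 1 / l) * \<phi> l)"

definition is_partition :: "real \<Rightarrow> real \<Rightarrow> nat \<Rightarrow> (nat \<Rightarrow> real) \<Rightarrow> bool" where
  "is_partition lmax T n \<tau> \<longleftrightarrow>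
     \<tau> 0 = 0 \<and> \<tau> (Suc n) = T - 1 / lmax \<and> (\<forall>i\<le>n. \<tau> i < \<tau> (Suc i))"

text \<open>
  A control is a function on \<open>I_ctrl\<close>, represented by its extension by zero to the real line. The
  cells are half-open, so its value at the right end point of \<open>I_ctrl\<close> is unconstrained.
\<close>

definition U :: "real \<Rightarrow> real \<Rightarrow> nat \<Rightarrow> (nat \<Rightarrow> real) \<Rightarrow> (real \<Rightarrow> real) set" where
  "U lmax T n \<tau> =
     {u. (\<exists>c::nat \<Rightarrow> real. \<forall>i\<le>n. \<forall>t\<in>{\<tau> i..<\<tau> (Suc i)}. u t = c i) \<and>
         (\<forall>t. t \<notin> I_ctrl lmax T \<longrightarrow> u t = 0)}"

definition H ::
    "'a measure \<Rightarrow> real \<Rightarrow> real \<Rightarrow> ('a \<Rightarrow> real) \<Rightarrow> (real \<Rightarrow> 'a \<Rightarrow> real) \<Rightarrow> (real \<Rightarrow> real) \<Rightarrow> real" where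
  "H M lmin T lam D u =
     (LINT s:{1 / lmin..T}|lborel. (\<integral>\<omega>. (u (s - 1 / lam \<omega>) - D s \<omega>)\<^sup>2 \<partial>M))"

definition Q ::
    "real \<Rightarrow> real \<Rightarrow> real \<Rightarrow> (real \<Rightarrow> real) \<Rightarrow> (nat \<Rightarrow> real) \<Rightarrow> nat \<Rightarrow> real" where
  "Q lmin lmax T \<phi> \<tau> i = (LINT t:{\<tau> i..\<tau> (Suc i)}|lborel. q lmin lmax T \<phi> t)"

definition MM ::
    "real \<Rightarrow> real \<Rightarrow> real \<Rightarrow> (real \<Rightarrow> real) \<Rightarrow> (real \<Rightarrow> real) \<Rightarrow> (nat \<Rightarrow> real) \<Rightarrow> nat \<Rightarrow> real" where
  "MM lmin lmax T \<phi> m \<tau> i =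
     (LINT t:{\<tau> i..\<tau> (Suc i)}|lborel.
       (LINT l:Lam lmin lmax T t|lborel. m (t + 1 / l) * \<phi> l))"

end

theory Submission
  imports Defs
begin

text \<open>
  For almost every \<open>s\<close>, independence lets the mixed term of the expanded square factor, so the inner
  expectation is \<open>E[u(s - 1/lam)\<^sup>2] - 2 E[u(s - 1/lam)] m(s) + E[D(s)\<^sup>2]\<close>. Writing the expectations
  over \<open>lam\<close> as integrals against \<open>\<phi>\<close>, exchanging them with the integral over \<open>s\<close> and substituting
  \<open>t = s - 1/l\<close> gives \<open>H u = \<integral> u\<^sup>2 q - 2 \<integral> u g + K\<close> with \<open>g = q u_star\<close>. On step functions this is a
  decoupled sum of the quadratics \<open>c i\<^sup>2 Q i - 2 c i M i\<close>, and \<open>M i = 0\<close> whenever \<open>Q i = 0\<close>.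
\<close>

section \<open>Fubini and translation for integrals of shifted products\<close>

lemma integrable_mult_bounded:
  fixes f g :: "'b \<Rightarrow> real"
  assumes "integrable N f" "g \<in> borel_measurable N" "\<And>x. \<bar>g x\<bar> \<le> C"
  shows "integrable N (\<lambda>x. f x * g x)"
proof (rule Bochner_Integration.integrable_bound[where f="\<lambda>x. C * f x"])
  show "integrable N (\<lambda>x. C * f x)" using assms by simp
  show "(\<lambda>x. f x * g x) \<in> borel_measurable N" using assms by measurable
  have "\<bar>f x * g x\<bar> \<le> \<bar>C * f x\<bar>" for x
  proof -
    have "\<bar>g x\<bar> \<le> \<bar>C\<bar>" using assms(3)[of x] by linarith
    then show ?thesis by (simp add: abs_mult mult.commute[of _ "\<bar>f x\<bar>"] mult_left_mono)
  qed
  then show "AE x in N. norm (f x * g x) \<le> norm (C * f x)" by simp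
qed

text \<open>For fixed \<open>l\<close> the integral of \<open>\<bar>h (t + k l)\<bar>\<close> over
  \<open>t\<close> does not depend on the shift, so the iterated integral of the absolute value is
  the product of the two L1 norms, and Tonelli's criterion applies.\<close>

lemma integrable_shift_prod:
  fixes w h k :: "real \<Rightarrow> real"
  assumes w: "integrable lborel w" and h: "integrable lborel h"
    and [measurable]: "k \<in> borel_measurable borel"
  shows "integrable (lborel \<Otimes>\<^sub>M lborel) (\<lambda>(l, t). h (t + k l) * w l)"
proof -
  have [measurable]: "w \<in> borel_measurable borel" "h \<in> borel_measurable borel"
    using w h by auto
  have shift: "integrable lborel (\<lambda>t. h (t + a))" for a
    using lborel_integrable_real_affine[OF h, of 1 a] by (simp add: add.commute)
  have shift_abs: "(\<integral>t. \<bar>h (t + a)\<bar> \<partial>lborel) = (\<integral>t. \<bar>h t\<bar> \<partial>lborel)" for a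
    using lborel_integral_real_affine[of 1 "\<lambda>t. \<bar>h t\<bar>" a] by (simp add: add.commute)
  show ?thesis
  proof (rule lborel_pair.Fubini_integrable)
    show "integrable lborel (\<lambda>l. \<integral>t. norm (case (l, t) of (l, t) \<Rightarrow> h (t + k l) * w l) \<partial>lborel)"
      using w by (simp add: abs_mult shift_abs)
    show "AE l in lborel. integrable lborel (\<lambda>t. case (l, t) of (l, t) \<Rightarrow> h (t + k l) * w l)"
      using shift by simp
  qed measurable
qed

lemma integrable_shift:
  fixes w h k :: "real \<Rightarrow> real"
  assumes "integrable lborel w" "integrable lborel h" "k \<in> borel_measurable borel"
  shows "integrable lborel (\<lambda>t. \<integral>l. h (t + k l) * w l \<partial>lborel)"
  using lborel_pair.integrable_snd[OF integrable_shift_prod[OF assms]] by simp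

text \<open>Fubini moves the \<open>l\<close>-integral outside, where the shift \<open>k l\<close>
  is a constant and \<open>s = t + k l\<close> is a plain translation; Fubini then moves it back
  inside. The bound on \<open>v\<close> keeps both double integrands integrable.\<close>

lemma
  fixes w h k v :: "real \<Rightarrow> real"
  assumes w: "integrable lborel w" and h: "integrable lborel h"
    and k[measurable]: "k \<in> borel_measurable borel" and v[measurable]: "v \<in> borel_measurable borel"
    and bd: "\<And>t. \<bar>v t\<bar> \<le> C"
  shows integrable_mult_shift: "integrable lborel (\<lambda>s. h s * (\<integral>l. v (s - k l) * w l \<partial>lborel))"
    and integral_shift_swap:
      "(\<integral>s. h s * (\<integral>l. v (s - k l) * w l \<partial>lborel) \<partial>lborel) =
       (\<integral>t. v t * (\<integral>l. h (t + k l) * w l \<partial>lborel) \<partial>lborel)"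
proof -
  have [measurable]: "w \<in> borel_measurable borel" "h \<in> borel_measurable borel"
    using w h by auto
  note G = integrable_shift_prod[OF w h k]
  \<comment> \<open>The zero shift turns the previous lemma into integrability of the tensor product
    of \<open>h\<close> and \<open>w\<close>.\<close>
  have P: "integrable (lborel \<Otimes>\<^sub>M lborel) (\<lambda>(l, s). h s * w l)"
    using integrable_shift_prod[OF w h, of "\<lambda>_. 0"] by simp
  have F: "integrable (lborel \<Otimes>\<^sub>M lborel) (\<lambda>(l, s). h s * (v (s - k l) * w l))"
    using integrable_mult_bounded[OF P, of "\<lambda>(l, s). v (s - k l)" C] bd
    by (simp add: split_beta' mult_ac)
  have G': "integrable (lborel \<Otimes>\<^sub>M lborel) (\<lambda>(l, t). v t * (h (t + k l) * w l))"
    using integrable_mult_bounded[OF G, of "\<lambda>(l, t). v t" C] bd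
    by (simp add: split_beta' mult_ac)
  show "integrable lborel (\<lambda>s. h s * (\<integral>l. v (s - k l) * w l \<partial>lborel))"
    using lborel_pair.integrable_snd[OF F] by simp
  have "(\<integral>s. h s * (\<integral>l. v (s - k l) * w l \<partial>lborel) \<partial>lborel) =
      (\<integral>l. (\<integral>s. h s * (v (s - k l) * w l) \<partial>lborel) \<partial>lborel)"
    using lborel_pair.Fubini_integral[OF F] by simp
  also have "\<dots> = (\<integral>l. (\<integral>t. v t * (h (t + k l) * w l) \<partial>lborel) \<partial>lborel)"
  proof -
    have "(\<integral>s. h s * (v (s - k l) * w l) \<partial>lborel) = (\<integral>t. v t * (h (t + k l) * w l) \<partial>lborel)" for l
      using lborel_integral_real_affine[of 1 "\<lambda>s. h s * (v (s - k l) * w l)" "k l"]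
      by (simp add: mult_ac add.commute)
    then show ?thesis by simp
  qed
  also have "\<dots> = (\<integral>t. v t * (\<integral>l. h (t + k l) * w l \<partial>lborel) \<partial>lborel)"
    using lborel_pair.Fubini_integral[OF G'] by simp
  finally show "(\<integral>s. h s * (\<integral>l. v (s - k l) * w l \<partial>lborel) \<partial>lborel) =
       (\<integral>t. v t * (\<integral>l. h (t + k l) * w l \<partial>lborel) \<partial>lborel)" .
qed

section \<open>Step functions on the partition\<close>

text \<open>The ordering of the end points is carried through the induction because gluing the next
  cell to the interval built so far depends on it.\<close>

lemma sum_indicator_cells:
  fixes \<tau> :: "nat \<Rightarrow> real"
  assumes "\<forall>i\<le>n. \<tau> i < \<tau> (Suc i)"
  shows "\<tau> 0 < \<tau> (Suc n) \<and>
    (\<Sum>i\<le>n. indicator {\<tau> i..<\<tau> (Suc i)} t) = (indicator {\<tau> 0..<\<tau> (Suc n)} t :: real)"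
  using assms
proof (induction n)
  case (Suc n)
  then have "\<tau> 0 < \<tau> (Suc n)" "\<tau> (Suc n) < \<tau> (Suc (Suc n))"
    "(\<Sum>i\<le>n. indicator {\<tau> i..<\<tau> (Suc i)} t) = (indicator {\<tau> 0..<\<tau> (Suc n)} t :: real)"
    by auto
  then show ?case by (auto simp: indicator_def)
qed simp

text \<open>The half-open cells miss the right end of \<open>I_ctrl\<close>, where the value of a
  control is free; the last summand records that value.\<close>

lemma U_decomp:
  assumes "is_partition lmax T n \<tau>" "u \<in> U lmax T n \<tau>"
    and c: "\<forall>i\<le>n. \<forall>t\<in>{\<tau> i..<\<tau> (Suc i)}. u t = c i"
  shows "u t = (\<Sum>i\<le>n. c i * indicator {\<tau> i..<\<tau> (Suc i)} t) +
      u (T - 1 / lmax) * indicator {T - 1 / lmax} t"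
proof -
  let ?e = "T - 1 / lmax"
  have p: "\<tau> 0 = 0" "\<tau> (Suc n) = ?e" "\<forall>i\<le>n. \<tau> i < \<tau> (Suc i)"
    using assms(1) by (auto simp: is_partition_def)
  have cover: "0 < ?e" "(\<Sum>i\<le>n. indicator {\<tau> i..<\<tau> (Suc i)} t) = (indicator {0..<?e} t :: real)"
    using sum_indicator_cells[OF p(3), of t] p by auto
  have "u t = u t * indicator {0..<?e} t + u ?e * indicator {?e} t"
    using assms(2) cover(1) by (auto simp: U_def I_ctrl_def indicator_def less_le)
  \<comment> \<open>The cell indicators form a partition of unity on the half-open interval.\<close>
  also have "u t * indicator {0..<?e} t = (\<Sum>i\<le>n. u t * indicator {\<tau> i..<\<tau> (Suc i)} t)"
    by (simp add: cover(2)[symmetric] sum_distrib_left)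
  also have "\<dots> = (\<Sum>i\<le>n. c i * indicator {\<tau> i..<\<tau> (Suc i)} t)"
    using c by (intro sum.cong) (auto simp: indicator_def)
  finally show ?thesis .
qed

text \<open>Any prescribed coefficients are realized by some control, here the one with value 0 at
  the right end point. This later supplies the minimizer.\<close>

lemma step_in_U:
  assumes "is_partition lmax T n \<tau>"
  obtains u where "u \<in> U lmax T n \<tau>" "\<forall>i\<le>n. \<forall>t\<in>{\<tau> i..<\<tau> (Suc i)}. u t = c i"
proof -
  let ?u = "\<lambda>t. \<Sum>i\<le>n. c i * indicator {\<tau> i..<\<tau> (Suc i)} t"
  have p: "\<tau> 0 = 0" "\<tau> (Suc n) = T - 1 / lmax" "\<forall>i\<le>n. \<tau> i < \<tau> (Suc i)"
    using assms by (auto simp: is_partition_def)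
  have S: "(\<Sum>i\<le>n. indicator {\<tau> i..<\<tau> (Suc i)} t) = (indicator {0..<T - 1 / lmax} t :: real)" for t
    using sum_indicator_cells[OF p(3), of t] p by simp
  have val: "?u t = c i" if i: "i \<le> n" and t: "t \<in> {\<tau> i..<\<tau> (Suc i)}" for i t
  proof -
    let ?I = "\<lambda>j. indicator {\<tau> j..<\<tau> (Suc j)} t :: real"
    \<comment> \<open>Disjointness of the cells without comparing end points: the nonnegative
      indicators sum to at most 1, so when one equals 1 the others vanish.\<close>
    have "(\<Sum>j\<le>n. ?I j) = ?I i + (\<Sum>j\<in>{..n} - {i}. ?I j)"
      using i by (intro sum.remove) auto
    moreover have "(\<Sum>j\<le>n. ?I j) \<le> 1" unfolding S by (simp add: indicator_def)
    moreover have "?I i = 1" using t by simp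
    moreover have "(\<Sum>j\<in>{..n} - {i}. ?I j) \<ge> 0" by (intro sum_nonneg) auto
    ultimately have "(\<Sum>j\<in>{..n} - {i}. ?I j) = 0" by linarith
    then have "\<forall>j\<in>{..n} - {i}. ?I j = 0"
      by (subst (asm) sum_nonneg_eq_0_iff) auto
    then have "?u t = c i * ?I i + (\<Sum>j\<in>{..n} - {i}. 0)"
      using i by (subst sum.remove[of _ i]) (auto intro!: sum.neutral)
    then show ?thesis using t by simp
  qed
  have out: "?u t = 0" if "t \<notin> I_ctrl lmax T" for t
  proof -
    have "(\<Sum>i\<le>n. indicator {\<tau> i..<\<tau> (Suc i)} t) = (0::real)"
      using that unfolding S by (auto simp: I_ctrl_def)
    then have "\<forall>j\<in>{..n}. (indicator {\<tau> j..<\<tau> (Suc j)} t :: real) = 0"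
      by (subst (asm) sum_nonneg_eq_0_iff) auto
    then show ?thesis by (intro sum.neutral) auto
  qed
  show ?thesis
    by (rule that[of ?u]) (use val out in \<open>auto simp: U_def\<close>)
qed

text \<open>Controls are constant on half-open cells while \<open>Q\<close> and \<open>MM\<close>
  integrate over closed ones; the discrepancy is confined to finitely many points.\<close>

lemma integral_U:
  assumes "is_partition lmax T n \<tau>" "u \<in> U lmax T n \<tau>"
    and c: "\<forall>i\<le>n. \<forall>t\<in>{\<tau> i..<\<tau> (Suc i)}. u t = c i"
    and g: "integrable lborel g"
  shows "(\<integral>t. u t * g t \<partial>lborel) = (\<Sum>i\<le>n. c i * (LINT t:{\<tau> i..\<tau> (Suc i)}|lborel. g t))"
proof -
  let ?e = "T - 1 / lmax"
  have [measurable]: "g \<in> borel_measurable borel" using g by auto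
  have gi: "integrable lborel (\<lambda>t. c i * (indicator {\<tau> i..\<tau> (Suc i)} t * g t))" for i
    using integrable_mult_indicator[OF _ g, of "{\<tau> i..\<tau> (Suc i)}"] by simp
  have m: "u \<in> borel_measurable borel"
    by (subst U_decomp[OF assms(1-3), abs_def]) measurable
  \<comment> \<open>Discarding all partition points removes both the shared ends of neighbouring
    closed cells and the free value at \<open>\<tau> (Suc n)\<close>.\<close>
  have "AE t in lborel. \<forall>i\<in>{..Suc n}. t \<noteq> \<tau> i"
    by (subst AE_finite_all) (auto intro: AE_lborel_singleton)
  moreover have "u t * g t = (\<Sum>i\<le>n. c i * (indicator {\<tau> i..\<tau> (Suc i)} t * g t))"
    if t: "\<forall>i\<in>{..Suc n}. t \<noteq> \<tau> i" for t
  proof -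
    have "?e = \<tau> (Suc n)" using assms(1) by (simp add: is_partition_def)
    then have "u t = (\<Sum>i\<le>n. c i * indicator {\<tau> i..<\<tau> (Suc i)} t)"
      using U_decomp[OF assms(1-3), of t] t by simp
    also have "\<dots> = (\<Sum>i\<le>n. c i * indicator {\<tau> i..\<tau> (Suc i)} t)"
      using t by (intro sum.cong) (auto simp: indicator_def less_le)
    finally show ?thesis by (simp only: sum_distrib_right mult.assoc)
  qed
  ultimately have "AE t in lborel. u t * g t = (\<Sum>i\<le>n. c i * (indicator {\<tau> i..\<tau> (Suc i)} t * g t))"
    by auto
  then have "(\<integral>t. u t * g t \<partial>lborel) = (\<integral>t. (\<Sum>i\<le>n. c i * (indicator {\<tau> i..\<tau> (Suc i)} t * g t)) \<partial>lborel)"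
    using m by (intro integral_cong_AE) auto
  also have "\<dots> = (\<Sum>i\<le>n. c i * (LINT t:{\<tau> i..\<tau> (Suc i)}|lborel. g t))"
    unfolding set_lebesgue_integral_def
    by (subst Bochner_Integration.integral_sum) (use gi in auto)
  finally show ?thesis .
qed

section \<open>Independence and expectations over \<open>lam\<close>\<close>

text \<open>The sigma-algebra of one variable \<open>D s\<close> lies inside that of the process,
  and independence passes to smaller families.\<close>

lemma indep_var_process:
  assumes "prob_space M" "lam \<in> borel_measurable M" "indep_rv_process M T lam D"
    and s: "s \<in> {0..T}" "D s \<in> borel_measurable M"
  shows "prob_space.indep_var M borel lam borel (D s)"
proof -
  interpret prob_space M by fact
  have "indep_set (sigma_sets (space M) {lam -` B \<inter> space M | B. B \<in> sets borel})
      (sigma_sets (space M) {D s -` B \<inter> space M | B. B \<in> sets borel})"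
    using assms(3) unfolding indep_rv_process_def indep_set_def
  proof (rule indep_sets_mono_sets)
    fix b :: bool
    have "sigma_sets (space M) {D s -` B \<inter> space M | B. B \<in> sets borel} \<subseteq>
        sigma_sets (space M) {D t -` B \<inter> space M | t B. t \<in> {0..T} \<and> B \<in> sets borel}"
      using s by (intro sigma_sets_mono') blast
    then show "case_bool (sigma_sets (space M) {lam -` B \<inter> space M | B. B \<in> sets borel})
          (sigma_sets (space M) {D s -` B \<inter> space M | B. B \<in> sets borel}) b \<subseteq>
        case_bool (sigma_sets (space M) {lam -` B \<inter> space M | B. B \<in> sets borel})
          (sigma_sets (space M) {D t -` B \<inter> space M | t B. t \<in> {0..T} \<and> B \<in> sets borel}) b"
      by (cases b) auto
  qed
  then show ?thesis
    using assms by (simp add: indep_var_eq)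
qed

text \<open>Independence is inherited by \<open>v (X \<omega>)\<close> and factors the mixed term of
  the expanded square. Boundedness of \<open>v\<close> and the finite second moment of
  \<open>Y\<close> make all three terms integrable on a probability space.\<close>

lemma (in prob_space) expectation_square_diff_indep:
  fixes X Y :: "'a \<Rightarrow> real"
  assumes ind: "indep_var borel X borel Y" and v[measurable]: "v \<in> borel_measurable borel"
    and bd: "\<And>t. \<bar>v t\<bar> \<le> C" and Y2: "integrable M (\<lambda>\<omega>. (Y \<omega>)\<^sup>2)"
  shows "expectation (\<lambda>\<omega>. (v (X \<omega>) - Y \<omega>)\<^sup>2) =
    expectation (\<lambda>\<omega>. (v (X \<omega>))\<^sup>2) - 2 * (expectation (\<lambda>\<omega>. v (X \<omega>)) * expectation Y) +
    expectation (\<lambda>\<omega>. (Y \<omega>)\<^sup>2)"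
proof -
  have [measurable]: "random_variable borel X" "random_variable borel Y"
    using ind by (simp_all add: indep_var_eq)
  have Y: "integrable M Y"
    using square_integrable_imp_integrable[of Y] Y2 by simp
  have vX: "integrable M (\<lambda>\<omega>. v (X \<omega>))"
    using integrable_mult_bounded[of M "\<lambda>_. 1" "\<lambda>\<omega>. v (X \<omega>)" C] bd by simp
  have vX2: "integrable M (\<lambda>\<omega>. (v (X \<omega>))\<^sup>2)"
    using integrable_mult_bounded[OF vX, of "\<lambda>\<omega>. v (X \<omega>)" C] bd by (simp add: power2_eq_square)
  have ind': "indep_var borel (\<lambda>\<omega>. v (X \<omega>)) borel Y"
    using indep_var_compose[OF ind, of v borel id borel] by (simp add: comp_def)
  note XY = indep_var_integrable[OF ind' vX Y] indep_var_lebesgue_integral[OF ind' vX Y]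
  have "expectation (\<lambda>\<omega>. (v (X \<omega>) - Y \<omega>)\<^sup>2) =
      expectation (\<lambda>\<omega>. (v (X \<omega>))\<^sup>2 - 2 * (v (X \<omega>) * Y \<omega>) + (Y \<omega>)\<^sup>2)"
    by (simp add: power2_diff algebra_simps)
  also have "\<dots> = expectation (\<lambda>\<omega>. (v (X \<omega>))\<^sup>2) - 2 * expectation (\<lambda>\<omega>. v (X \<omega>) * Y \<omega>) +
      expectation (\<lambda>\<omega>. (Y \<omega>)\<^sup>2)"
    using vX2 XY(1) Y2 by simp
  finally show ?thesis by (simp add: XY(2))
qed

text \<open>The indicator of the range is almost surely 1 under the expectation, so it may be
  inserted there and then carried over to the density, which matches the restriction to
  \<open>{lmin..lmax}\<close> in \<open>Lam\<close>.\<close>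

lemma distributed_expectation_AE_Icc:
  fixes lam :: "'a \<Rightarrow> real"
  assumes lam[measurable]: "lam \<in> borel_measurable M"
    and ae: "AE \<omega> in M. a \<le> lam \<omega> \<and> lam \<omega> \<le> b"
    and dist: "distributed M lborel lam (\<lambda>x. ennreal (\<phi> x))" and pos: "\<And>x. 0 \<le> \<phi> x"
    and f[measurable]: "f \<in> borel_measurable borel"
  shows "(\<integral>\<omega>. f (lam \<omega>) \<partial>M) = (\<integral>l. f l * (indicator {a..b} l * \<phi> l) \<partial>lborel)"
proof -
  have "(\<integral>\<omega>. f (lam \<omega>) \<partial>M) = (\<integral>\<omega>. f (lam \<omega>) * indicator {a..b} (lam \<omega>) \<partial>M)"
    using ae by (intro integral_cong_AE) (auto simp: indicator_def)
  also have "\<dots> = (\<integral>l. \<phi> l * (f l * indicator {a..b} l) \<partial>lborel)"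
    using dist pos by (intro distributed_integral[symmetric]) auto
  finally show ?thesis by (simp add: mult_ac)
qed

section \<open>Measurability and moments of the process \<open>D\<close>\<close>

text \<open>Joint measurability is available only for times in \<open>A\<close>. The extension by
  zero, with the coordinates swapped, lives on the full product with \<open>lborel\<close>, where
  Fubini can be used.\<close>

lemma process_measurable:
  fixes D :: "real \<Rightarrow> 'a \<Rightarrow> real"
  assumes meas: "(\<lambda>(t, \<omega>). D t \<omega>) \<in> borel_measurable (restrict_space borel A \<Otimes>\<^sub>M M)"
    and A: "A \<in> sets borel"
  shows "\<And>s. s \<in> A \<Longrightarrow> D s \<in> borel_measurable M"
    and "(\<lambda>(\<omega>, s). indicator A s * D s \<omega>) \<in> borel_measurable (M \<Otimes>\<^sub>M lborel)"
proof -
  show "D s \<in> borel_measurable M" if "s \<in> A" for s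
  proof -
    have "(\<lambda>\<omega>. (s, \<omega>)) \<in> M \<rightarrow>\<^sub>M restrict_space borel A \<Otimes>\<^sub>M M"
      using that by (intro measurable_Pair measurable_const) (auto simp: space_restrict_space)
    from measurable_compose[OF this meas] show ?thesis by simp
  qed
  have "(\<lambda>x. (snd x, fst x)) \<in> restrict_space (M \<Otimes>\<^sub>M lborel) (space M \<times> A) \<rightarrow>\<^sub>M
      restrict_space borel A \<Otimes>\<^sub>M M"
    by (intro measurable_Pair measurable_restrict_space2 measurable_restrict_space1)
      (auto simp: space_restrict_space space_pair_measure)
  from measurable_compose[OF this meas]
  have "(\<lambda>x. D (snd x) (fst x)) \<in>
      borel_measurable (restrict_space (M \<Otimes>\<^sub>M lborel) (space M \<times> A))"
    by simp
  then have "(\<lambda>x. indicator (space M \<times> A) x *\<^sub>R D (snd x) (fst x)) \<in>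
      borel_measurable (M \<Otimes>\<^sub>M lborel)"
    using A by (subst (asm) borel_measurable_restrict_space_iff) (auto intro: sets.Int)
  then show "(\<lambda>(\<omega>, s). indicator A s * D s \<omega>) \<in> borel_measurable (M \<Otimes>\<^sub>M lborel)"
    by (rule measurable_cong[THEN iffD1, rotated])
      (auto simp: space_pair_measure indicator_def)
qed

text \<open>Fubini applied to the square-integrable process gives the statements on second moments;
  the mean is dominated by 1 plus the second moment.\<close>

lemma process_moments:
  fixes D :: "real \<Rightarrow> 'a \<Rightarrow> real"
  assumes "prob_space M"
    and meas: "(\<lambda>(t, \<omega>). D t \<omega>) \<in> borel_measurable (restrict_space borel {0..T} \<Otimes>\<^sub>M M)"
    and sq: "set_integrable (M \<Otimes>\<^sub>M lborel) (space M \<times> {0<..<T}) (\<lambda>(\<omega>, t). (D t \<omega>)\<^sup>2)"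
    and a: "0 < a" "a \<le> T"
  shows "AE s in lborel. s \<in> {a..T} \<longrightarrow> integrable M (\<lambda>\<omega>. (D s \<omega>)\<^sup>2)"
    and "integrable lborel (\<lambda>s. indicator {a..T} s * (\<integral>\<omega>. (D s \<omega>)\<^sup>2 \<partial>M))"
    and "integrable lborel (\<lambda>s. indicator {a..T} s * mean M D s)"
proof -
  interpret prob_space M by fact
  interpret P: pair_sigma_finite M "lborel :: real measure" ..
  let ?E = "\<lambda>(\<omega>, s). indicator {0..T} s * D s \<omega>"
  have Ds: "\<And>s. s \<in> {0..T} \<Longrightarrow> D s \<in> borel_measurable M"
    and E[measurable]: "?E \<in> borel_measurable (M \<Otimes>\<^sub>M lborel)"
    using process_measurable[OF meas] by auto
  have sq': "integrable (M \<Otimes>\<^sub>M lborel) (\<lambda>(\<omega>, s). indicator {0<..<T} s * (D s \<omega>)\<^sup>2)"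
    using sq unfolding set_integrable_def
    by (rule Bochner_Integration.integrable_cong[THEN iffD1, rotated -1])
      (auto simp: space_pair_measure indicator_def)
  \<comment> \<open>Square integrability is stated on the open interval; since \<open>a\<close> is
    positive, \<open>T\<close> is the only point of \<open>{a..T}\<close> outside it.\<close>
  have neT: "AE s in lborel. s \<noteq> T" by (rule AE_lborel_singleton)
  from P.AE_integrable_snd[OF sq'] neT
  show ae: "AE s in lborel. s \<in> {a..T} \<longrightarrow> integrable M (\<lambda>\<omega>. (D s \<omega>)\<^sup>2)"
    by eventually_elim (use a in \<open>auto simp: indicator_def\<close>)
  \<comment> \<open>On \<open>{a..T}\<close> the process agrees with its extension
    \<open>?E\<close>, whose joint measurability makes the partial integral measurable in
    \<open>s\<close>.\<close>
  have m2: "(\<lambda>s. indicator {a..T} s * (\<integral>\<omega>. (D s \<omega>)\<^sup>2 \<partial>M)) \<in> borel_measurable borel"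
  proof -
    have "(\<lambda>s. indicator {a..T} s * (\<integral>\<omega>. (D s \<omega>)\<^sup>2 \<partial>M)) =
        (\<lambda>s. indicator {a..T} s * (\<integral>\<omega>. (?E (\<omega>, s))\<^sup>2 \<partial>M))"
      using a by (auto simp: indicator_def fun_eq_iff)
    then show ?thesis by (simp only:) measurable
  qed
  have m1: "(\<lambda>s. indicator {a..T} s * mean M D s) \<in> borel_measurable borel"
  proof -
    have "(\<lambda>s. indicator {a..T} s * mean M D s) =
        (\<lambda>s. indicator {a..T} s * (\<integral>\<omega>. ?E (\<omega>, s) \<partial>M))"
      using a by (auto simp: indicator_def fun_eq_iff mean_def)
    then show ?thesis by (simp only:) measurable
  qed
  show i2: "integrable lborel (\<lambda>s. indicator {a..T} s * (\<integral>\<omega>. (D s \<omega>)\<^sup>2 \<partial>M))"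
  proof (rule Bochner_Integration.integrable_bound)
    show "integrable lborel (\<lambda>s. \<integral>\<omega>. indicator {0<..<T} s * (D s \<omega>)\<^sup>2 \<partial>M)"
      using P.integrable_snd[OF sq'] by simp
    show "AE s in lborel. norm (indicator {a..T} s * (\<integral>\<omega>. (D s \<omega>)\<^sup>2 \<partial>M)) \<le>
        norm (\<integral>\<omega>. indicator {0<..<T} s * (D s \<omega>)\<^sup>2 \<partial>M)"
      using neT by eventually_elim (use a in \<open>auto simp: indicator_def\<close>)
  qed (use m2 in simp)
  show "integrable lborel (\<lambda>s. indicator {a..T} s * mean M D s)"
  proof (rule Bochner_Integration.integrable_bound)
    show "integrable lborel (\<lambda>s. indicator {a..T} s * (1::real) + indicator {a..T} s * (\<integral>\<omega>. (D s \<omega>)\<^sup>2 \<partial>M))"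
      using i2 by (intro Bochner_Integration.integrable_add)
        (auto intro!: integrable_real_indicator simp: emeasure_lborel_Icc_eq)
    show "AE s in lborel. norm (indicator {a..T} s * mean M D s) \<le>
        norm (indicator {a..T} s * (1::real) + indicator {a..T} s * (\<integral>\<omega>. (D s \<omega>)\<^sup>2 \<partial>M))"
      using ae
    proof eventually_elim
      case (elim s)
      show ?case
      proof (cases "s \<in> {a..T}")
        case True
        then have i: "integrable M (\<lambda>\<omega>. (D s \<omega>)\<^sup>2)" using elim by simp
        have [measurable]: "D s \<in> borel_measurable M" using Ds[of s] True a by auto
        have "\<bar>mean M D s\<bar> \<le> (\<integral>\<omega>. \<bar>D s \<omega>\<bar> \<partial>M)"
          unfolding mean_def by (rule integral_abs_bound)
        also have "\<dots> \<le> (\<integral>\<omega>. 1 + (D s \<omega>)\<^sup>2 \<partial>M)"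
        proof (rule integral_mono)
          show "integrable M (\<lambda>\<omega>. \<bar>D s \<omega>\<bar>)"
            using square_integrable_imp_integrable[of "D s"] i by simp
          \<comment> \<open>The square of \<open>\<bar>D s \<omega>\<bar> - 1/2\<close> being
            nonnegative even gives the constant 1/4.\<close>
          show "\<bar>D s \<omega>\<bar> \<le> 1 + (D s \<omega>)\<^sup>2" for \<omega>
            using zero_le_power2[of "\<bar>D s \<omega>\<bar> - 1/2"] by (simp add: power2_diff power2_eq_square algebra_simps)
        qed (use i in simp)
        also have "\<dots> = 1 + (\<integral>\<omega>. (D s \<omega>)\<^sup>2 \<partial>M)"
          using i by (simp add: prob_space)
        finally show ?thesis using True by simp
      qed simp
    qed
  qed (use m1 in simp)
qed

section \<open>The cost as a quadratic functional of the control\<close>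

text \<open>Stated for all bounded Borel controls: the bound makes every integral finite, so the
  cost splits, and its last term is independent of \<open>u\<close>.\<close>

lemma H_expansion:
  fixes D :: "real \<Rightarrow> 'a \<Rightarrow> real"
  assumes "prob_space M"
    and l: "0 < lmin" "T > 1 / lmin"
    and A1: "lam \<in> borel_measurable M" "AE \<omega> in M. lmin \<le> lam \<omega> \<and> lam \<omega> \<le> lmax"
    and A2: "\<And>x. 0 \<le> \<phi> x" "distributed M lborel lam (\<lambda>x. ennreal (\<phi> x))"
    and A3: "(\<lambda>(t, \<omega>). D t \<omega>) \<in> borel_measurable (restrict_space borel {0..T} \<Otimes>\<^sub>M M)"
      "set_integrable (M \<Otimes>\<^sub>M lborel) (space M \<times> {0<..<T}) (\<lambda>(\<omega>, t). (D t \<omega>)\<^sup>2)"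
    and A5: "indep_rv_process M T lam D"
  defines "g \<equiv> \<lambda>t. LINT l:Lam lmin lmax T t|lborel. mean M D (t + 1 / l) * \<phi> l"
  shows "integrable lborel (q lmin lmax T \<phi>)" "integrable lborel g"
    and "\<And>u C. u \<in> borel_measurable borel \<Longrightarrow> (\<And>t. \<bar>u t\<bar> \<le> C) \<Longrightarrow>
      H M lmin T lam D u =
        (\<integral>t. (u t)\<^sup>2 * q lmin lmax T \<phi> t \<partial>lborel) - 2 * (\<integral>t. u t * g t \<partial>lborel) +
        (\<integral>s. indicator {1 / lmin..T} s * (\<integral>\<omega>. (D s \<omega>)\<^sup>2 \<partial>M) \<partial>lborel)"
proof -
  interpret prob_space M by fact
  define w where "w l = indicator {lmin..lmax} l * \<phi> l" for l
  define J :: "real \<Rightarrow> real" where "J = indicator {1 / lmin..T}"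
  define h where "h s = J s * mean M D s" for s
  define k :: "real \<Rightarrow> real" where "k l = 1 / l" for l
  have a: "0 < 1 / lmin" "1 / lmin \<le> T" using l by auto
  note mom = process_moments[OF \<open>prob_space M\<close> A3 a]
  have \<phi>: "integrable lborel \<phi>"
    using distributed_integrable[OF A2(2), of "\<lambda>_. 1"] A2(1) by simp
  have w: "integrable lborel w"
    using integrable_mult_indicator[OF _ \<phi>, of "{lmin..lmax}"] by (simp add: w_def[abs_def])
  have k[measurable]: "k \<in> borel_measurable borel" unfolding k_def[abs_def] by measurable
  have J: "integrable lborel J" unfolding J_def by (rule integrable_real_indicator) (auto simp: emeasure_lborel_Icc_eq)
  have h: "integrable lborel h" unfolding h_def[abs_def] J_def by (rule mom)
  \<comment> \<open>The two conditions defining \<open>Lam\<close> separate: the time window becomes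
    \<open>J\<close> at the shifted argument and the range of \<open>l\<close> is absorbed in
    \<open>w\<close>. Hence \<open>q\<close> and \<open>g\<close> are shift integrals of
    \<open>J\<close> and of \<open>h\<close>.\<close>
  have q_eq: "q lmin lmax T \<phi> = (\<lambda>t. \<integral>l. J (t + k l) * w l \<partial>lborel)"
    unfolding q_def set_lebesgue_integral_def
    by (intro ext Bochner_Integration.integral_cong) (auto simp: J_def k_def w_def Lam_def indicator_def)
  have g_eq: "g = (\<lambda>t. \<integral>l. h (t + k l) * w l \<partial>lborel)"
    unfolding g_def set_lebesgue_integral_def
    by (intro ext Bochner_Integration.integral_cong) (auto simp: J_def k_def w_def h_def Lam_def indicator_def)
  show "integrable lborel (q lmin lmax T \<phi>)" unfolding q_eq by (rule integrable_shift[OF w J k])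
  show "integrable lborel g" unfolding g_eq by (rule integrable_shift[OF w h k])
  fix u :: "real \<Rightarrow> real" and C
  assume u[measurable]: "u \<in> borel_measurable borel" and bd: "\<And>t. \<bar>u t\<bar> \<le> C"
  have u2: "(\<lambda>t. (u t)\<^sup>2) \<in> borel_measurable borel" by measurable
  have bd2: "\<bar>(u t)\<^sup>2\<bar> \<le> C\<^sup>2" for t
    using power_mono[OF bd[of t], of 2] by simp
  let ?A = "\<lambda>s. J s * (\<integral>l. (u (s - k l))\<^sup>2 * w l \<partial>lborel)"
  let ?B = "\<lambda>s. h s * (\<integral>l. u (s - k l) * w l \<partial>lborel)"
  let ?C = "\<lambda>s. J s * (\<integral>\<omega>. (D s \<omega>)\<^sup>2 \<partial>M)"
  have iA: "integrable lborel ?A" by (rule integrable_mult_shift[OF w J k u2 bd2])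
  have iB: "integrable lborel ?B" by (rule integrable_mult_shift[OF w h k u bd])
  have iC: "integrable lborel ?C" unfolding J_def by (rule mom)
  \<comment> \<open>The identity is claimed only where the second moment is finite, which is almost
    every \<open>s\<close> of the window; outside the window every term vanishes through
    \<open>J\<close>.\<close>
  have pt: "J s * (\<integral>\<omega>. (u (s - 1 / lam \<omega>) - D s \<omega>)\<^sup>2 \<partial>M) = ?A s - 2 * ?B s + ?C s"
    if s: "s \<in> {1 / lmin..T} \<longrightarrow> integrable M (\<lambda>\<omega>. (D s \<omega>)\<^sup>2)" for s
  proof (cases "s \<in> {1 / lmin..T}")
    case True
    then have s0: "s \<in> {0..T}" using a(1) unfolding atLeastAtMost_iff by linarith
    have ind: "indep_var borel lam borel (D s)"
      using process_measurable(1)[OF A3(1) _ s0]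
      by (intro indep_var_process[OF \<open>prob_space M\<close> A1(1) A5 s0]) simp
    have E: "(\<integral>\<omega>. v (s - 1 / lam \<omega>) \<partial>M) = (\<integral>l. v (s - k l) * w l \<partial>lborel)"
      if [measurable]: "v \<in> borel_measurable borel" for v :: "real \<Rightarrow> real"
      using distributed_expectation_AE_Icc[OF A1 A2(2,1), of "\<lambda>l. v (s - 1 / l)"]
      by (simp add: w_def k_def)
    have "(\<integral>\<omega>. (u (s - 1 / lam \<omega>) - D s \<omega>)\<^sup>2 \<partial>M) =
        (\<integral>\<omega>. (u (s - 1 / lam \<omega>))\<^sup>2 \<partial>M) - 2 * ((\<integral>\<omega>. u (s - 1 / lam \<omega>) \<partial>M) * mean M D s) +
        (\<integral>\<omega>. (D s \<omega>)\<^sup>2 \<partial>M)"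
      unfolding mean_def
      by (rule expectation_square_diff_indep[OF ind, of "\<lambda>l. u (s - 1 / l)"]) (use s True bd in auto)
    then show ?thesis
      using True E[OF u] E[OF u2] by (simp add: h_def J_def)
  next
    case False
    then show ?thesis by (simp add: h_def J_def)
  qed
  have "AE s in lborel. ?A s - 2 * ?B s + ?C s = J s * (\<integral>\<omega>. (u (s - 1 / lam \<omega>) - D s \<omega>)\<^sup>2 \<partial>M)"
    using mom(1) by eventually_elim (simp only: pt)
  \<comment> \<open>Needed to pass from almost everywhere equality to equal integrals; replacing
    \<open>D\<close> by its extension by zero changes nothing where \<open>J\<close> is
    nonzero.\<close>
  moreover have "(\<lambda>s. J s * (\<integral>\<omega>. (u (s - 1 / lam \<omega>) - D s \<omega>)\<^sup>2 \<partial>M)) \<in> borel_measurable lborel"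
  proof -
    let ?E = "\<lambda>(\<omega>, s). indicator {0..T} s * D s \<omega>"
    have [measurable]: "?E \<in> borel_measurable (M \<Otimes>\<^sub>M lborel)" "lam \<in> borel_measurable M"
        "J \<in> borel_measurable borel"
      using process_measurable(2)[OF A3(1)] A1 J by auto
    have "(\<lambda>s. J s * (\<integral>\<omega>. (u (s - 1 / lam \<omega>) - D s \<omega>)\<^sup>2 \<partial>M)) =
        (\<lambda>s. J s * (\<integral>\<omega>. (u (s - 1 / lam \<omega>) - ?E (\<omega>, s))\<^sup>2 \<partial>M))"
      using a by (auto simp: J_def indicator_def fun_eq_iff simp del: zero_less_divide_1_iff)
    then show ?thesis by (simp only:) measurable
  qed
  ultimately have "H M lmin T lam D u = (\<integral>s. ?A s - 2 * ?B s + ?C s \<partial>lborel)"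
    unfolding H_def set_lebesgue_integral_def J_def[symmetric] real_scaleR_def
    by (intro integral_cong_AE[symmetric]) (use iA iB iC in auto)
  also have "\<dots> = (\<integral>s. ?A s \<partial>lborel) - 2 * (\<integral>s. ?B s \<partial>lborel) + (\<integral>s. ?C s \<partial>lborel)"
    using iA iB iC by simp
  also have "(\<integral>s. ?A s \<partial>lborel) = (\<integral>t. (u t)\<^sup>2 * q lmin lmax T \<phi> t \<partial>lborel)"
    unfolding q_eq by (rule integral_shift_swap[OF w J k u2 bd2])
  also have "(\<integral>s. ?B s \<partial>lborel) = (\<integral>t. u t * g t \<partial>lborel)"
    unfolding g_eq by (rule integral_shift_swap[OF w h k u bd])
  finally show "H M lmin T lam D u =
        (\<integral>t. (u t)\<^sup>2 * q lmin lmax T \<phi> t \<partial>lborel) - 2 * (\<integral>t. u t * g t \<partial>lborel) +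
        (\<integral>s. indicator {1 / lmin..T} s * (\<integral>\<omega>. (D s \<omega>)\<^sup>2 \<partial>M) \<partial>lborel)"
    by (simp add: J_def)
qed

section \<open>Minimization over the step controls\<close>

lemma U_measurable_bounded:
  assumes "is_partition lmax T n \<tau>" "u \<in> U lmax T n \<tau>"
  shows "u \<in> borel_measurable borel" and "\<exists>C. \<forall>t. \<bar>u t\<bar> \<le> C"
proof -
  obtain c where c: "\<forall>i\<le>n. \<forall>t\<in>{\<tau> i..<\<tau> (Suc i)}. u t = c i"
    using assms(2) by (auto simp: U_def)
  note dec = U_decomp[OF assms c]
  show "u \<in> borel_measurable borel"
    by (subst dec[abs_def]) measurable
  have "\<bar>u t\<bar> \<le> (\<Sum>i\<le>n. \<bar>c i\<bar>) + \<bar>u (T - 1 / lmax)\<bar>" for t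
  proof -
    have "\<bar>u t\<bar> \<le> \<bar>\<Sum>i\<le>n. c i * indicator {\<tau> i..<\<tau> (Suc i)} t\<bar> +
        \<bar>u (T - 1 / lmax) * indicator {T - 1 / lmax} t\<bar>"
      by (subst dec) (rule abs_triangle_ineq)
    also have "\<dots> \<le> (\<Sum>i\<le>n. \<bar>c i\<bar>) + \<bar>u (T - 1 / lmax)\<bar>"
      by (intro add_mono order_trans[OF sum_abs] sum_mono) (auto simp: indicator_def)
    finally show ?thesis .
  qed
  then show "\<exists>C. \<forall>t. \<bar>u t\<bar> \<le> C" by blast
qed

text \<open>A nonnegative weight with zero integral vanishes almost everywhere on the set. This
  serves twice: for \<open>\<phi>\<close> on \<open>Lam\<close> where \<open>q\<close> is 0, and for
  \<open>q\<close> on a cell where \<open>Q\<close> is 0.\<close>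

lemma set_integral_mult_eq_0:
  fixes f \<phi> :: "'b \<Rightarrow> real"
  assumes "set_integrable N A \<phi>" "\<And>x. 0 \<le> \<phi> x" "(LINT x:A|N. \<phi> x) = 0"
  shows "(LINT x:A|N. f x * \<phi> x) = 0"
proof -
  have "AE x in N. indicator A x *\<^sub>R \<phi> x = 0"
    using assms integral_nonneg_eq_0_iff_AE[of N "\<lambda>x. indicator A x *\<^sub>R \<phi> x"]
    by (auto simp: set_integrable_def set_lebesgue_integral_def)
  then show ?thesis
    unfolding set_lebesgue_integral_def by (intro integral_eq_zero_AE) auto
qed

text \<open>Since \<open>b / 0 = 0\<close>, the completed square also covers the degenerate case,
  where both sides are 0; cells with \<open>Q\<close> equal to 0 thus need no separate
  treatment.\<close>

lemma quadratic_completion: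
  fixes x a b :: real
  assumes "a = 0 \<Longrightarrow> b = 0"
  shows "x\<^sup>2 * a - 2 * (x * b) = a * (x - b / a)\<^sup>2 - b\<^sup>2 / a"
  using assms by (cases "a = 0") (auto simp: field_simps power2_eq_square)

theorem proposition3p3:
  fixes M :: "'a measure"
    and lmin lmax T :: real
    and lam :: "'a \<Rightarrow> real"
    and \<phi> :: "real \<Rightarrow> real"
    and D :: "real \<Rightarrow> 'a \<Rightarrow> real"
    and n :: nat
    and \<tau> :: "nat \<Rightarrow> real"
  assumes "prob_space M"
    and "0 < lmin" "lmin < lmax" "T > 1 / lmin"
    and A1: "lam \<in> borel_measurable M" "AE \<omega> in M. lmin \<le> lam \<omega> \<and> lam \<omega> \<le> lmax"
    and A2: "C1_on_Icc (cdf (distr M borel lam)) lmin lmax"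
      "\<And>x. 0 \<le> \<phi> x" "distributed M lborel lam (\<lambda>x. ennreal (\<phi> x))"
    and A3: "\<And>t \<omega>. t \<in> {0..T} \<Longrightarrow> \<omega> \<in> space M \<Longrightarrow> 0 \<le> D t \<omega>"
      "(\<lambda>(t, \<omega>). D t \<omega>) \<in> borel_measurable (restrict_space borel {0..T} \<Otimes>\<^sub>M M)"
      "set_integrable (M \<Otimes>\<^sub>M lborel) (space M \<times> {0<..<T}) (\<lambda>(\<omega>, t). (D t \<omega>)\<^sup>2)"
    and A5: "indep_rv_process M T lam D"
    and partition: "is_partition lmax T n \<tau>"
  shows "(\<exists>u. is_arg_min (H M lmin T lam D) (\<lambda>v. v \<in> U lmax T n \<tau>) u) \<and>
    (\<forall>i\<le>n. Q lmin lmax T \<phi> \<tau> i > 0 \<longrightarrow>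
      (\<forall>u. is_arg_min (H M lmin T lam D) (\<lambda>v. v \<in> U lmax T n \<tau>) u \<longrightarrow>
        (\<forall>t\<in>{\<tau> i..<\<tau> (Suc i)}.
          u t = MM lmin lmax T \<phi> (mean M D) \<tau> i / Q lmin lmax T \<phi> \<tau> i)) \<and>
      MM lmin lmax T \<phi> (mean M D) \<tau> i / Q lmin lmax T \<phi> \<tau> i =
        (LINT t:{\<tau> i..\<tau> (Suc i)}|lborel.
          q lmin lmax T \<phi> t * u_star lmin lmax T \<phi> (mean M D) t) /
        (LINT t:{\<tau> i..\<tau> (Suc i)}|lborel. q lmin lmax T \<phi> t))"
proof -
  let ?q = "q lmin lmax T \<phi>" and ?Q = "Q lmin lmax T \<phi> \<tau>"
  let ?M = "MM lmin lmax T \<phi> (mean M D) \<tau>" and ?H = "H M lmin T lam D"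
  let ?us = "u_star lmin lmax T \<phi> (mean M D)" and ?U = "U lmax T n \<tau>"
  define g where "g t = (LINT l:Lam lmin lmax T t|lborel. mean M D (t + 1 / l) * \<phi> l)" for t
  define K where "K = (\<integral>s. indicator {1 / lmin..T} s * (\<integral>\<omega>. (D s \<omega>)\<^sup>2 \<partial>M) \<partial>lborel)"
  note H_exp = H_expansion[OF assms(1,2,4) A1 A2(2,3) A3(2,3) A5, folded g_def K_def]
  interpret prob_space M by fact
  have \<phi>: "integrable lborel \<phi>"
    using distributed_integrable[OF A2(3), of "\<lambda>_. 1"] A2(2) by simp
  have q_nonneg: "0 \<le> ?q t" for t
    unfolding q_def set_lebesgue_integral_def using A2(2) by (intro integral_nonneg_AE) auto
  \<comment> \<open>Where \<open>?q t\<close> is 0 the right side is 0 by the convention for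
    division, and the left side is 0 because \<open>\<phi>\<close> vanishes almost everywhere on
    \<open>Lam\<close>.\<close>
  have g_eq: "g t = ?q t * ?us t" for t
  proof (cases "?q t = 0")
    case True
    have "set_integrable lborel (Lam lmin lmax T t) \<phi>"
      unfolding set_integrable_def
      by (rule integrable_mult_indicator[OF _ \<phi>]) (simp add: Lam_def)
    then have "g t = 0"
      using True A2(2) unfolding g_def q_def by (intro set_integral_mult_eq_0)
    with True show ?thesis by simp
  next
    case False
    then show ?thesis by (simp add: u_star_def g_def)
  qed
  have M_eq: "?M i = (LINT t:{\<tau> i..\<tau> (Suc i)}|lborel. ?q t * ?us t)" for i
    by (simp add: MM_def g_def[symmetric] g_eq)
  have QM: "?M i = 0" if "?Q i = 0" for i
  proof -
    have "set_integrable lborel {\<tau> i..\<tau> (Suc i)} ?q"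
      unfolding set_integrable_def by (rule integrable_mult_indicator[OF _ H_exp(1)]) simp
    then have "(LINT t:{\<tau> i..\<tau> (Suc i)}|lborel. ?us t * ?q t) = 0"
      using that q_nonneg unfolding Q_def by (intro set_integral_mult_eq_0)
    then show ?thesis by (simp add: M_eq mult.commute)
  qed
  have Q_nonneg: "0 \<le> ?Q i" for i
    unfolding Q_def set_lebesgue_integral_def using q_nonneg by (intro integral_nonneg_AE) auto
  \<comment> \<open>\<open>K'\<close> collects what remains after completing the squares and turns
    out to be the minimal cost.\<close>
  define K' where "K' = K - (\<Sum>i\<le>n. (?M i)\<^sup>2 / ?Q i)"
  have H_val: "?H u = (\<Sum>i\<le>n. ?Q i * (c i - ?M i / ?Q i)\<^sup>2) + K'"
    if u: "u \<in> ?U" and c: "\<forall>i\<le>n. \<forall>t\<in>{\<tau> i..<\<tau> (Suc i)}. u t = c i" for u c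
  proof -
    obtain C where C: "\<And>t. \<bar>u t\<bar> \<le> C"
      using U_measurable_bounded(2)[OF partition u] by blast
    \<comment> \<open>The square of a step control is again one, with squared coefficients, so
      \<open>integral_U\<close> evaluates the quadratic term too.\<close>
    have "(\<lambda>t. (u t)\<^sup>2) \<in> ?U" using u c by (auto simp: U_def intro!: exI[of _ "\<lambda>i. (c i)\<^sup>2"])
    then have "(\<integral>t. (u t)\<^sup>2 * ?q t \<partial>lborel) = (\<Sum>i\<le>n. (c i)\<^sup>2 * ?Q i)"
      using c unfolding Q_def by (intro integral_U[OF partition _ _ H_exp(1)]) auto
    moreover have "(\<integral>t. u t * g t \<partial>lborel) = (\<Sum>i\<le>n. c i * ?M i)"
      unfolding MM_def g_def[symmetric] by (rule integral_U[OF partition u c H_exp(2)])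
    ultimately have "?H u = (\<Sum>i\<le>n. (c i)\<^sup>2 * ?Q i - 2 * (c i * ?M i)) + K"
      using H_exp(3)[OF U_measurable_bounded(1)[OF partition u] C] by (simp add: sum_subtractf sum_distrib_left)
    also have "\<dots> = (\<Sum>i\<le>n. ?Q i * (c i - ?M i / ?Q i)\<^sup>2 - (?M i)\<^sup>2 / ?Q i) + K"
      using quadratic_completion[OF QM] by simp
    finally show ?thesis by (simp add: K'_def sum_subtractf)
  qed
  \<comment> \<open>All squares vanish for this choice; on cells with \<open>?Q i = 0\<close> the
    coefficient is 0 by division by zero.\<close>
  obtain u0 where u0: "u0 \<in> ?U" "\<forall>i\<le>n. \<forall>t\<in>{\<tau> i..<\<tau> (Suc i)}. u0 t = ?M i / ?Q i"
    by (rule step_in_U[OF partition, where c = "\<lambda>i. ?M i / ?Q i"])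
  have H_u0: "?H u0 = K'" using H_val[OF u0] by simp
  have H_ge: "K' \<le> ?H u" if u: "u \<in> ?U" for u
  proof -
    obtain c where "\<forall>i\<le>n. \<forall>t\<in>{\<tau> i..<\<tau> (Suc i)}. u t = c i"
      using u by (auto simp: U_def)
    from H_val[OF u this] show ?thesis using Q_nonneg by (simp add: sum_nonneg)
  qed
  have "is_arg_min ?H (\<lambda>v. v \<in> ?U) u0"
    using u0(1) H_u0 H_ge by (auto simp: is_arg_min_def not_less)
  moreover have "u t = ?M i / ?Q i"
    if i: "i \<le> n" "0 < ?Q i" and u: "is_arg_min ?H (\<lambda>v. v \<in> ?U) u"
      and t: "t \<in> {\<tau> i..<\<tau> (Suc i)}" for i u t
  proof -
    have uU: "u \<in> ?U" and "?H u \<le> K'"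
      using u u0(1) H_u0 by (auto simp: is_arg_min_def not_less)
    then obtain c where c: "\<forall>i\<le>n. \<forall>t\<in>{\<tau> i..<\<tau> (Suc i)}. u t = c i"
      by (auto simp: U_def)
    \<comment> \<open>A minimizer attains \<open>K'\<close>, so the weighted squares sum to 0 and
      each one vanishes; a positive weight then fixes its coefficient.\<close>
    have "(\<Sum>i\<le>n. ?Q i * (c i - ?M i / ?Q i)\<^sup>2) = 0"
      using H_val[OF uU c] \<open>?H u \<le> K'\<close> H_ge[OF uU] by simp
    then have "?Q i * (c i - ?M i / ?Q i)\<^sup>2 = 0"
      using i(1) Q_nonneg by (subst (asm) sum_nonneg_eq_0_iff) auto
    then show ?thesis using i c t by simp
  qed
  ultimately show ?thesis
    by (auto simp: M_eq[symmetric] Q_def[symmetric])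
qed

end
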